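(* For any $\mathrm{B}_0$-category $\mathcal{B}$, there is an equivalence of categories $\Phi\colon \mathbb{B}(\mathbb{A}(\mathcal{B}))\to\mathcal{B}$ given on objects by $$\Phi((X_1,\ldots,X_n)) = X_1\amalg\cdots\amalg X_n.$$
   Context: In a category with finite co-products, write $\mathbf{0}$ for the initial object; an object is empty if it is isomorphic to $\mathbf{0}$. An object $X$ is an atom (atomic) if it is non-empty and, whenever $X \cong Y \amalg Z$, either $Y$ or $Z$ is empty. A $\mathrm{B}_0$-category is an essentially small category $\mathcal{B}$ such that: it has finite co-products; every object is isomorphic to a finite co-product of atoms; and for objects $X,Y,Z$ with $X$ atomic, the natural map $\mathrm{Hom}(X,Y)\amalg \mathrm{Hom}(X,Z)\to \mathrm{Hom}(X,Y\amalg Z)$ is a bijection. $\mathbb{A}(\mathcal{B})$ is the full subcategory of $\mathcal{B}^{\mathrm{op}}$ spanned by the atoms of $\mathcal{B}$. For an essentially small category $\mathcal{A}$, the category $\mathbb{B}(\mathcal{A})$ has as objects the finite (possibly empty) sequences $(X_1,\dots,X_n)$ of objects of $\mathcal{A}$; a morphism $(X_1,\dots,X_n)\to(Y_1,\dots,Y_m)$ is a function $a\colon\{1,\dots,n\}\to\{1,\dots,m\}$ together with, for each $i$, a morphism $X_i\to Y_{a(i)}$ in $\mathcal{A}^{\mathrm{op}}$; composition is the obvious one. On morphisms, $\Phi$ is the evident map: $(a,(f_i))$ is sent to the morphism whose restriction to $X_i$ is $f_i\colon X_i\to Y_{a(i)}$ followed by the co-product inclusion. *)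

theory Defs
  imports Main
begin

section \<open>Categories\<close>

text \<open>
  Categories are given by a set of objects and a set of arrows, with source, target,
  identities and composition; \<open>cmp C g f\<close> is ``\<open>g\<close> after \<open>f\<close>''. The operations
  are total HOL functions whose values are only meaningful on objects, arrows and
  composable pairs.

  Since objects and arrows form HOL sets, every such category is small (hence essentially
  small) relative to the HOL universe, so essential smallness appears nowhere as a separate
  condition.
\<close>

record ('o, 'm) cat =
  obj :: "'o set"
  arr :: "'m set"
  src :: "'m \<Rightarrow> 'o"
  tgt :: "'m \<Rightarrow> 'o"
  ident :: "'o \<Rightarrow> 'm"
  cmp :: "'m \<Rightarrow> 'm \<Rightarrow> 'm"

definition hom :: "('o, 'm) cat \<Rightarrow> 'o \<Rightarrow> 'o \<Rightarrow> 'm set" where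
  "hom C X Y = {f \<in> arr C. src C f = X \<and> tgt C f = Y}"

locale category =
  fixes C :: "('o, 'm) cat"
  assumes src_in_obj: "f \<in> arr C \<Longrightarrow> src C f \<in> obj C"
    and tgt_in_obj: "f \<in> arr C \<Longrightarrow> tgt C f \<in> obj C"
    and ident_in_hom: "X \<in> obj C \<Longrightarrow> ident C X \<in> hom C X X"
    and cmp_in_hom: "f \<in> hom C X Y \<Longrightarrow> g \<in> hom C Y Z \<Longrightarrow> cmp C g f \<in> hom C X Z"
    and cmp_ident_right: "f \<in> hom C X Y \<Longrightarrow> cmp C f (ident C X) = f"
    and cmp_ident_left: "f \<in> hom C X Y \<Longrightarrow> cmp C (ident C Y) f = f"
    and cmp_assoc: "f \<in> hom C W X \<Longrightarrow> g \<in> hom C X Y \<Longrightarrow> h \<in> hom C Y Z \<Longrightarrow>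
           cmp C h (cmp C g f) = cmp C (cmp C h g) f"

definition iso_arr :: "('o, 'm) cat \<Rightarrow> 'o \<Rightarrow> 'o \<Rightarrow> 'm \<Rightarrow> bool" where
  "iso_arr C X Y f \<longleftrightarrow>
     f \<in> hom C X Y \<and> (\<exists>g \<in> hom C Y X. cmp C g f = ident C X \<and> cmp C f g = ident C Y)"

definition isomorphic :: "('o, 'm) cat \<Rightarrow> 'o \<Rightarrow> 'o \<Rightarrow> bool" where
  "isomorphic C X Y \<longleftrightarrow> X \<in> obj C \<and> Y \<in> obj C \<and> (\<exists>f. iso_arr C X Y f)"

definition op_cat :: "('o, 'm) cat \<Rightarrow> ('o, 'm) cat" where
  "op_cat C = \<lparr>obj = obj C, arr = arr C, src = tgt C, tgt = src C,
               ident = ident C, cmp = (\<lambda>g f. cmp C f g)\<rparr>"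

definition full_subcat :: "('o, 'm) cat \<Rightarrow> 'o set \<Rightarrow> ('o, 'm) cat" where
  "full_subcat C S = \<lparr>obj = obj C \<inter> S, arr = {f \<in> arr C. src C f \<in> S \<and> tgt C f \<in> S},
               src = src C, tgt = tgt C, ident = ident C, cmp = cmp C\<rparr>"


section \<open>Functors and equivalences\<close>

record ('o1, 'm1, 'o2, 'm2) func =
  fobj :: "'o1 \<Rightarrow> 'o2"
  farr :: "'m1 \<Rightarrow> 'm2"

definition is_functor ::
  "('o1, 'm1) cat \<Rightarrow> ('o2, 'm2) cat \<Rightarrow> ('o1, 'm1, 'o2, 'm2) func \<Rightarrow> bool" where
  "is_functor C D F \<longleftrightarrow>
     (\<forall>X \<in> obj C. fobj F X \<in> obj D) \<and>
     (\<forall>X \<in> obj C. \<forall>Y \<in> obj C. \<forall>f \<in> hom C X Y. farr F f \<in> hom D (fobj F X) (fobj F Y)) \<and>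
     (\<forall>X \<in> obj C. farr F (ident C X) = ident D (fobj F X)) \<and>
     (\<forall>X \<in> obj C. \<forall>Y \<in> obj C. \<forall>Z \<in> obj C. \<forall>f \<in> hom C X Y. \<forall>g \<in> hom C Y Z.
        farr F (cmp C g f) = cmp D (farr F g) (farr F f))"

definition id_func :: "('o, 'm, 'o, 'm) func" where
  "id_func = \<lparr>fobj = (\<lambda>X. X), farr = (\<lambda>f. f)\<rparr>"

definition comp_func ::
  "('o2, 'm2, 'o3, 'm3) func \<Rightarrow> ('o1, 'm1, 'o2, 'm2) func \<Rightarrow> ('o1, 'm1, 'o3, 'm3) func" where
  "comp_func G F = \<lparr>fobj = (\<lambda>X. fobj G (fobj F X)), farr = (\<lambda>f. farr G (farr F f))\<rparr>"

definition naturally_isomorphic ::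
  "('o1, 'm1) cat \<Rightarrow> ('o2, 'm2) cat \<Rightarrow>
   ('o1, 'm1, 'o2, 'm2) func \<Rightarrow> ('o1, 'm1, 'o2, 'm2) func \<Rightarrow> bool" where
  "naturally_isomorphic C D F G \<longleftrightarrow>
     (\<exists>\<eta>. (\<forall>X \<in> obj C. iso_arr D (fobj F X) (fobj G X) (\<eta> X)) \<and>
          (\<forall>X \<in> obj C. \<forall>Y \<in> obj C. \<forall>f \<in> hom C X Y.
             cmp D (\<eta> Y) (farr F f) = cmp D (farr G f) (\<eta> X)))"

definition is_equivalence ::
  "('o1, 'm1) cat \<Rightarrow> ('o2, 'm2) cat \<Rightarrow> ('o1, 'm1, 'o2, 'm2) func \<Rightarrow> bool" where
  "is_equivalence C D F \<longleftrightarrow>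
     category C \<and> category D \<and> is_functor C D F \<and>
     (\<exists>G. is_functor D C G \<and>
          naturally_isomorphic C C id_func (comp_func G F) \<and>
          naturally_isomorphic D D (comp_func F G) id_func)"


section \<open>Finite co-products and atoms\<close>

text \<open>
  \<open>is_coproduct C Xs P \<iota>\<close>: the object \<open>P\<close> together with the inclusions
  \<open>\<iota> 0, \<dots>, \<iota> (n - 1)\<close> is a co-product of the finite sequence \<open>Xs\<close> of length \<open>n\<close>.
  For \<open>n = 0\<close> this says that \<open>P\<close> is initial.
\<close>

definition is_coproduct ::
  "('o, 'm) cat \<Rightarrow> 'o list \<Rightarrow> 'o \<Rightarrow> (nat \<Rightarrow> 'm) \<Rightarrow> bool" where
  "is_coproduct C Xs P \<iota> \<longleftrightarrow>
     set Xs \<subseteq> obj C \<and> P \<in> obj C \<and>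
     (\<forall>i < length Xs. \<iota> i \<in> hom C (Xs ! i) P) \<and>
     (\<forall>Y \<in> obj C. \<forall>f. (\<forall>i < length Xs. f i \<in> hom C (Xs ! i) Y) \<longrightarrow>
        (\<exists>!h. h \<in> hom C P Y \<and> (\<forall>i < length Xs. cmp C h (\<iota> i) = f i)))"

definition has_finite_coproducts :: "('o, 'm) cat \<Rightarrow> bool" where
  "has_finite_coproducts C \<longleftrightarrow>
     (\<forall>Xs. set Xs \<subseteq> obj C \<longrightarrow> (\<exists>P \<iota>. is_coproduct C Xs P \<iota>))"

definition is_initial :: "('o, 'm) cat \<Rightarrow> 'o \<Rightarrow> bool" where
  "is_initial C Z \<longleftrightarrow> Z \<in> obj C \<and> (\<forall>Y \<in> obj C. \<exists>!f. f \<in> hom C Z Y)"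

definition is_empty :: "('o, 'm) cat \<Rightarrow> 'o \<Rightarrow> bool" where
  "is_empty C X \<longleftrightarrow> (\<exists>Z. is_initial C Z \<and> isomorphic C X Z)"

definition is_atom :: "('o, 'm) cat \<Rightarrow> 'o \<Rightarrow> bool" where
  "is_atom C X \<longleftrightarrow>
     X \<in> obj C \<and> \<not> is_empty C X \<and>
     (\<forall>Y \<in> obj C. \<forall>Z \<in> obj C. \<forall>P \<iota>.
        is_coproduct C [Y, Z] P \<iota> \<and> isomorphic C X P \<longrightarrow> is_empty C Y \<or> is_empty C Z)"


section \<open>The categories in question\<close>

locale B0_category = category B for B :: "('o, 'm) cat" +
  assumes finite_coproducts: "has_finite_coproducts B"
    and coproduct_of_atoms: "X \<in> obj B \<Longrightarrow>
           \<exists>Xs P \<iota>. (\<forall>Y \<in> set Xs. is_atom B Y) \<and> is_coproduct B Xs P \<iota> \<and> isomorphic B X P"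
    and hom_atom_coproduct: "is_atom B X \<Longrightarrow> Y \<in> obj B \<Longrightarrow> Z \<in> obj B \<Longrightarrow>
           is_coproduct B [Y, Z] P \<iota> \<Longrightarrow>
           bij_betw (case_sum (\<lambda>f. cmp B (\<iota> 0) f) (\<lambda>f. cmp B (\<iota> 1) f))
             (hom B X Y <+> hom B X Z) (hom B X P)"

definition atom_cat :: "('o, 'm) cat \<Rightarrow> ('o, 'm) cat" where
  "atom_cat B = full_subcat (op_cat B) {X. is_atom B X}"

text \<open>
  A morphism of finite sequences carries its source and target. The function
  \<open>a : {0..<n} \<rightarrow> {0..<m}\<close> is the list of its values and the family of components is a
  list as well, so that equality of morphisms is equality of the data. Indices start at \<open>0\<close>.
\<close>

datatype ('o, 'm) seq_arr =
  SeqArr (seq_src: "'o list") (seq_tgt: "'o list") (index: "nat list") (comps: "'m list")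

definition seq_cat :: "('o, 'm) cat \<Rightarrow> ('o list, ('o, 'm) seq_arr) cat" where
  "seq_cat A = \<lparr>
     obj = {Xs. set Xs \<subseteq> obj A},
     arr = {u. set (seq_src u) \<subseteq> obj A \<and> set (seq_tgt u) \<subseteq> obj A \<and>
               length (index u) = length (seq_src u) \<and>
               length (comps u) = length (seq_src u) \<and>
               (\<forall>i < length (seq_src u).
                  index u ! i < length (seq_tgt u) \<and>
                  comps u ! i \<in> hom (op_cat A) (seq_src u ! i) (seq_tgt u ! (index u ! i)))},
     src = seq_src,
     tgt = seq_tgt,
     ident = (\<lambda>Xs. SeqArr Xs Xs [0..<length Xs] (map (ident (op_cat A)) Xs)),
     cmp = (\<lambda>v u. SeqArr (seq_src u) (seq_tgt v)
               (map (\<lambda>i. index v ! (index u ! i)) [0..<length (seq_src u)])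
               (map (\<lambda>i. cmp (op_cat A) (comps v ! (index u ! i)) (comps u ! i))
                  [0..<length (seq_src u)]))\<rparr>"


section \<open>The constructions are categories\<close>

lemma hom_op_cat: "hom (op_cat C) X Y = hom C Y X"
  by (auto simp: hom_def op_cat_def)

lemma category_op_cat:
  assumes "category C" shows "category (op_cat C)"
proof -
  interpret category C by fact
  show ?thesis
    by unfold_locales
      (simp_all add: hom_op_cat, simp_all add: op_cat_def src_in_obj tgt_in_obj ident_in_hom
        cmp_in_hom cmp_ident_left cmp_ident_right cmp_assoc)
qed

lemma category_full_subcat:
  assumes "category C" shows "category (full_subcat C S)"
proof -
  interpret category C by fact
  have h: "hom (full_subcat C S) X Y = (if X \<in> S \<and> Y \<in> S then hom C X Y else {})" for X Y
    by (auto simp: hom_def full_subcat_def)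
  show ?thesis
    by unfold_locales
      (simp_all add: h split: if_splits, simp_all add: full_subcat_def src_in_obj tgt_in_obj
        ident_in_hom cmp_in_hom cmp_ident_left cmp_ident_right cmp_assoc)
qed

lemma category_seq_cat:
  assumes "category A" shows "category (seq_cat A)"
proof -
  interpret O: category "op_cat A" by (rule category_op_cat) fact
  have obj_op: "obj (op_cat A) = obj A" by (simp add: op_cat_def)
  show ?thesis
  proof
    fix X assume "X \<in> obj (seq_cat A)"
    then show "ident (seq_cat A) X \<in> hom (seq_cat A) X X"
      using O.ident_in_hom by (auto simp: seq_cat_def hom_def obj_op subset_iff)
  next
    fix f g X Y Z assume "f \<in> hom (seq_cat A) X Y" "g \<in> hom (seq_cat A) Y Z"
    then show "cmp (seq_cat A) g f \<in> hom (seq_cat A) X Z"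
      unfolding hom_def[of "seq_cat A"]
      by (auto simp: seq_cat_def intro: O.cmp_in_hom)
  next
    fix f X Y assume "f \<in> hom (seq_cat A) X Y"
    then show "cmp (seq_cat A) f (ident (seq_cat A) X) = f"
      unfolding hom_def[of "seq_cat A"]
      by (cases f) (auto simp: seq_cat_def intro!: nth_equalityI O.cmp_ident_right)
  next
    fix f X Y assume "f \<in> hom (seq_cat A) X Y"
    then show "cmp (seq_cat A) (ident (seq_cat A) Y) f = f"
      unfolding hom_def[of "seq_cat A"]
      by (cases f) (auto simp: seq_cat_def intro!: nth_equalityI O.cmp_ident_left)
  next
    fix f g h W X Y Z
    assume "f \<in> hom (seq_cat A) W X" "g \<in> hom (seq_cat A) X Y" "h \<in> hom (seq_cat A) Y Z"
    then show "cmp (seq_cat A) h (cmp (seq_cat A) g f) = cmp (seq_cat A) (cmp (seq_cat A) h g) f"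
      unfolding hom_def[of "seq_cat A"]
      by (auto simp: seq_cat_def intro!: nth_equalityI
          O.cmp_assoc[where W = "seq_src f ! i" and X = "seq_tgt f ! (index f ! i)"
            and Y = "seq_tgt g ! (index g ! (index f ! i))"
            and Z = "seq_tgt h ! (index h ! (index g ! (index f ! i)))" for i])
  qed (auto simp: seq_cat_def)
qed

end

theory Submission
  imports Defs
begin

text \<open>
  Finite co-products make the prescription on components a functor. The binary axiom on arrows out
  of an atom extends to all finite co-products: for longer sequences by splitting off the first
  summand, and for the empty sequence because \<open>\<zero> = \<zero> \<amalg> \<zero>\<close> with both inclusions the identity,
  so that injectivity rules out any arrow from an atom to \<open>\<zero>\<close>. Together with the universal property
  in the source this shows that \<open>\<Phi>\<close> is fully faithful; it is essentially surjective since every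
  object is a co-product of atoms.
\<close>

section \<open>Fully faithful, essentially surjective functors\<close>

lemma is_functorD:
  assumes "is_functor C D F" "X \<in> obj C"
  shows "fobj F X \<in> obj D"
    and "Y \<in> obj C \<Longrightarrow> f \<in> hom C X Y \<Longrightarrow> farr F f \<in> hom D (fobj F X) (fobj F Y)"
    and "farr F (ident C X) = ident D (fobj F X)"
    and "Y \<in> obj C \<Longrightarrow> f \<in> hom C X Y \<Longrightarrow> Z \<in> obj C \<Longrightarrow> g \<in> hom C Y Z \<Longrightarrow>
           farr F (cmp C g f) = cmp D (farr F g) (farr F f)"
  using assms by (simp_all add: is_functor_def)

lemma isomorphic_trans:
  assumes "category C" "isomorphic C X Y" "isomorphic C Y Z"
  shows "isomorphic C X Z"
proof -
  interpret category C by fact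
  obtain f f' where f: "f \<in> hom C X Y" "f' \<in> hom C Y X"
    "cmp C f' f = ident C X" "cmp C f f' = ident C Y"
    using assms unfolding isomorphic_def iso_arr_def by blast
  obtain g g' where g: "g \<in> hom C Y Z" "g' \<in> hom C Z Y"
    "cmp C g' g = ident C Y" "cmp C g g' = ident C Z"
    using assms unfolding isomorphic_def iso_arr_def by blast
  have "cmp C (cmp C f' g') (cmp C g f) = ident C X"
    using cmp_assoc[OF cmp_in_hom[OF f(1) g(1)] g(2) f(2)] cmp_assoc[OF f(1) g(1,2)] f g
    by (simp add: cmp_ident_left)
  moreover have "cmp C (cmp C g f) (cmp C f' g') = ident C Z"
    using cmp_assoc[OF cmp_in_hom[OF g(2) f(2)] f(1) g(1)] cmp_assoc[OF g(2) f(2,1)] f g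
    by (simp add: cmp_ident_left)
  ultimately have "iso_arr C X Z (cmp C g f)"
    unfolding iso_arr_def using cmp_in_hom[OF f(1) g(1)] cmp_in_hom[OF g(2) f(2)] by blast
  then show ?thesis
    using assms unfolding isomorphic_def by blast
qed

lemma isomorphic_sym: "isomorphic C X Y \<Longrightarrow> isomorphic C Y X"
  unfolding isomorphic_def iso_arr_def by blast

text \<open>For every \<open>Y\<close> in \<open>D\<close> choose a preimage object together with an
  isomorphism onto \<open>Y\<close>. Conjugating by these isomorphisms and lifting along the
  bijections on hom sets gives the quasi-inverse. Every equation in \<open>C\<close> is then proved
  by applying \<open>F\<close> and cancelling in \<open>D\<close>.\<close>

lemma is_equivalenceI:
  assumes C: "category C" and D: "category D" and F: "is_functor C D F"
    and ff: "\<And>X Y. X \<in> obj C \<Longrightarrow> Y \<in> obj C \<Longrightarrow>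
      bij_betw (farr F) (hom C X Y) (hom D (fobj F X) (fobj F Y))"
    and es: "\<And>Y. Y \<in> obj D \<Longrightarrow> \<exists>X \<in> obj C. isomorphic D (fobj F X) Y"
  shows "is_equivalence C D F"
proof -
  interpret C: category C by fact
  interpret D: category D by fact
  note Fo = is_functorD(1)[OF F] and Fa = is_functorD(2)[OF F]
    and Fi = is_functorD(3)[OF F] and Fc = is_functorD(4)[OF F]
  define lift where "lift X Y = inv_into (hom C X Y) (farr F)" for X Y
  have lift: "lift X Y k \<in> hom C X Y" "farr F (lift X Y k) = k"
    if "X \<in> obj C" "Y \<in> obj C" "k \<in> hom D (fobj F X) (fobj F Y)" for X Y k
    using ff[OF that(1,2)] that(3) unfolding lift_def
    by (auto simp: bij_betw_def inv_into_into f_inv_into_f)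
  have faithful: "f = f'"
    if "X \<in> obj C" "Y \<in> obj C" "f \<in> hom C X Y" "f' \<in> hom C X Y" "farr F f = farr F f'" for X Y f f'
    using ff[OF that(1,2)] that(3-5) by (auto simp: bij_betw_def dest: inj_onD)
  \<comment> \<open>The object, the isomorphism \<open>e\<close> and its inverse \<open>d\<close>
    are chosen together, so that both inverse laws hold for the chosen arrows.\<close>
  have "\<forall>Y \<in> obj D. \<exists>X e d. X \<in> obj C \<and> e \<in> hom D (fobj F X) Y \<and> d \<in> hom D Y (fobj F X) \<and>
      cmp D d e = ident D (fobj F X) \<and> cmp D e d = ident D Y"
    using es unfolding isomorphic_def iso_arr_def by blast
  then obtain g e d where
    g: "g Y \<in> obj C" and e: "e Y \<in> hom D (fobj F (g Y)) Y" and d: "d Y \<in> hom D Y (fobj F (g Y))"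
    and de: "cmp D (d Y) (e Y) = ident D (fobj F (g Y))" and ed: "cmp D (e Y) (d Y) = ident D Y"
    if "Y \<in> obj D" for Y
    by metis
  \<comment> \<open>An arrow \<open>h\<close> from \<open>Y\<close> to \<open>Z\<close> goes to the
    lift of \<open>d Z\<close> after \<open>h\<close> after \<open>e Y\<close>. Since
    \<open>farr\<close> receives only the arrow, the two objects are read off from
    \<open>h\<close>.\<close>
  define G where "G = \<lparr>fobj = g, farr = (\<lambda>h. lift (g (src D h)) (g (tgt D h))
      (cmp D (d (tgt D h)) (cmp D h (e (src D h)))))\<rparr>"
  have Go: "fobj G = g" by (simp add: G_def)
  have Ga: "farr G h \<in> hom C (g Y) (g Z)"
    and FG: "farr F (farr G h) = cmp D (d Z) (cmp D h (e Y))"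
    if "h \<in> hom D Y Z" "Y \<in> obj D" "Z \<in> obj D" for h Y Z
  proof -
    have "src D h = Y" "tgt D h = Z" using that by (auto simp: hom_def)
    moreover have "cmp D (d Z) (cmp D h (e Y)) \<in> hom D (fobj F (g Y)) (fobj F (g Z))"
      using that d e D.cmp_in_hom by blast
    ultimately show "farr G h \<in> hom C (g Y) (g Z)"
      and "farr F (farr G h) = cmp D (d Z) (cmp D h (e Y))"
      using lift g that by (simp_all add: G_def)
  qed
  have "is_functor D C G"
    unfolding is_functor_def Go
  proof (intro conjI ballI)
    fix X assume X: "X \<in> obj D"
    show "farr G (ident D X) = ident C (g X)"
    proof (rule faithful[OF g[OF X] g[OF X]])
      show "farr F (farr G (ident D X)) = farr F (ident C (g X))"
        using X FG[OF D.ident_in_hom[OF X] X X] D.cmp_ident_left[OF e[OF X]] de[OF X] Fi[OF g[OF X]]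
        by simp
    qed (use X Ga g D.ident_in_hom C.ident_in_hom in auto)
  next
    fix X Y Z h k
    assume X: "X \<in> obj D" and Y: "Y \<in> obj D" and Z: "Z \<in> obj D"
      and h: "h \<in> hom D X Y" and k: "k \<in> hom D Y Z"
    have kh: "cmp D k h \<in> hom D X Z" using h k by (rule D.cmp_in_hom)
    show "farr G (cmp D k h) = cmp C (farr G k) (farr G h)"
    \<comment> \<open>Applying \<open>F\<close> to the composite of the lifts produces the factor
      \<open>e Y\<close> after \<open>d Y\<close> in the middle; it is the identity and
      cancels.\<close>
    proof (rule faithful[OF g[OF X] g[OF Z]])
      have he: "cmp D h (e X) \<in> hom D (fobj F (g X)) Y"
        using h e[OF X] D.cmp_in_hom by blast
      have dhe: "cmp D (d Y) (cmp D h (e X)) \<in> hom D (fobj F (g X)) (fobj F (g Y))"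
        using he d[OF Y] D.cmp_in_hom by blast
      have ke: "cmp D k (e Y) \<in> hom D (fobj F (g Y)) Z"
        using k e[OF Y] D.cmp_in_hom by blast
      have "farr F (cmp C (farr G k) (farr G h)) = cmp D (farr F (farr G k)) (farr F (farr G h))"
        using Fc g Ga X Y Z h k by blast
      also have "\<dots> = cmp D (cmp D (d Z) (cmp D k (e Y))) (cmp D (d Y) (cmp D h (e X)))"
        using FG X Y Z h k by simp
      also have "\<dots> = cmp D (d Z) (cmp D (cmp D k (e Y)) (cmp D (d Y) (cmp D h (e X))))"
        using D.cmp_assoc[OF dhe ke d[OF Z]] by simp
      also have "cmp D (cmp D k (e Y)) (cmp D (d Y) (cmp D h (e X))) =
          cmp D k (cmp D (e Y) (cmp D (d Y) (cmp D h (e X))))"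
        using D.cmp_assoc[OF dhe e[OF Y] k] by simp
      also have "cmp D (e Y) (cmp D (d Y) (cmp D h (e X))) = cmp D h (e X)"
        using D.cmp_assoc[OF he d[OF Y] e[OF Y]] ed[OF Y] D.cmp_ident_left[OF he] by simp
      also have "cmp D k (cmp D h (e X)) = cmp D (cmp D k h) (e X)"
        using D.cmp_assoc[OF e[OF X] h k] .
      finally show "farr F (farr G (cmp D k h)) = farr F (cmp C (farr G k) (farr G h))"
        using FG[OF kh X Z] by simp
    qed (use X Y Z h k kh Ga C.cmp_in_hom in blast)+
  qed (use g Ga in auto)
  moreover have "naturally_isomorphic C C id_func (comp_func G F)"
  proof -
    \<comment> \<open>The unit at \<open>X\<close> lifts the chosen inverse \<open>d\<close> at the
      object \<open>fobj F X\<close>; the lift \<open>\<theta>\<close> of the matching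
      \<open>e\<close> will be its inverse.\<close>
    define \<eta> where "\<eta> X = lift X (g (fobj F X)) (d (fobj F X))" for X
    have FX: "fobj F X \<in> obj D" and gF: "g (fobj F X) \<in> obj C" if "X \<in> obj C" for X
      using that Fo g by auto
    have \<eta>: "\<eta> X \<in> hom C X (g (fobj F X))" "farr F (\<eta> X) = d (fobj F X)" if "X \<in> obj C" for X
      using lift[OF that gF[OF that] d[OF FX[OF that]]] by (simp_all add: \<eta>_def)
    have "iso_arr C X (g (fobj F X)) (\<eta> X)" if X: "X \<in> obj C" for X
    proof -
      define \<theta> where "\<theta> = lift (g (fobj F X)) X (e (fobj F X))"
      have \<theta>: "\<theta> \<in> hom C (g (fobj F X)) X" "farr F \<theta> = e (fobj F X)"
        using lift[OF gF[OF X] X e[OF FX[OF X]]] by (simp_all add: \<theta>_def)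
      have "cmp C \<theta> (\<eta> X) = ident C X"
      proof (rule faithful[OF X X])
        show "farr F (cmp C \<theta> (\<eta> X)) = farr F (ident C X)"
          using Fc[OF X gF[OF X] \<eta>(1)[OF X] X \<theta>(1)] \<eta>(2)[OF X] \<theta>(2) ed[OF FX[OF X]] Fi[OF X] by simp
      qed (use X C.ident_in_hom C.cmp_in_hom \<theta> \<eta> in blast)+
      moreover have "cmp C (\<eta> X) \<theta> = ident C (g (fobj F X))"
      proof (rule faithful[OF gF[OF X] gF[OF X]])
        show "farr F (cmp C (\<eta> X) \<theta>) = farr F (ident C (g (fobj F X)))"
          using Fc[OF gF[OF X] X \<theta>(1) gF[OF X] \<eta>(1)[OF X]] \<eta>(2)[OF X] \<theta>(2) de[OF FX[OF X]]
            Fi[OF gF[OF X]] by simp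
      qed (use X gF C.ident_in_hom C.cmp_in_hom \<theta> \<eta> in blast)+
      ultimately show ?thesis
        unfolding iso_arr_def using \<theta>(1) \<eta>(1)[OF X] by blast
    qed
    \<comment> \<open>Under \<open>F\<close> the right-hand side becomes \<open>d\<close> after
      \<open>farr F f\<close> after \<open>e\<close> after \<open>d\<close>, whose last two factors
      cancel; what is left is the image of the left-hand side.\<close>
    moreover have "cmp C (\<eta> Y) f = cmp C (farr G (farr F f)) (\<eta> X)"
      if X: "X \<in> obj C" and Y: "Y \<in> obj C" and f: "f \<in> hom C X Y" for X Y f
    proof (rule faithful[OF X gF[OF Y]])
      note Ff = Fa[OF X Y f]
      note GFf = Ga[OF Ff FX[OF X] FX[OF Y]]
      have "farr F (cmp C (farr G (farr F f)) (\<eta> X)) =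
          cmp D (cmp D (d (fobj F Y)) (cmp D (farr F f) (e (fobj F X)))) (d (fobj F X))"
        using Fc[OF X gF[OF X] \<eta>(1)[OF X] gF[OF Y] GFf] FG[OF Ff FX[OF X] FX[OF Y]] \<eta>(2)[OF X]
        by simp
      also have "\<dots> = cmp D (d (fobj F Y)) (cmp D (cmp D (farr F f) (e (fobj F X))) (d (fobj F X)))"
        using D.cmp_assoc[OF d[OF FX[OF X]] D.cmp_in_hom[OF e[OF FX[OF X]] Ff] d[OF FX[OF Y]]]
        by simp
      also have "cmp D (cmp D (farr F f) (e (fobj F X))) (d (fobj F X)) = farr F f"
        using D.cmp_assoc[OF d[OF FX[OF X]] e[OF FX[OF X]] Ff] ed[OF FX[OF X]]
          D.cmp_ident_right[OF Ff] by simp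
      finally show "farr F (cmp C (\<eta> Y) f) = farr F (cmp C (farr G (farr F f)) (\<eta> X))"
        using Fc[OF X Y f gF[OF Y] \<eta>(1)[OF Y]] \<eta>(2)[OF Y] by simp
      show "cmp C (\<eta> Y) f \<in> hom C X (g (fobj F Y))"
        using C.cmp_in_hom[OF f \<eta>(1)[OF Y]] .
      show "cmp C (farr G (farr F f)) (\<eta> X) \<in> hom C X (g (fobj F Y))"
        using C.cmp_in_hom[OF \<eta>(1)[OF X] GFf] .
    qed
    ultimately show ?thesis
      unfolding naturally_isomorphic_def id_func_def comp_func_def Go by (intro exI[of _ \<eta>]) simp
  qed
  moreover have "naturally_isomorphic D D (comp_func F G) id_func"
  proof -
    \<comment> \<open>The counit needs no lifting: its components are the chosen isomorphisms
      \<open>e\<close> themselves.\<close>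
    have "iso_arr D (fobj F (g Y)) Y (e Y)" if "Y \<in> obj D" for Y
      unfolding iso_arr_def using that e d de ed by blast
    moreover have "cmp D (e Z) (farr F (farr G h)) = cmp D h (e Y)"
      if Y: "Y \<in> obj D" and Z: "Z \<in> obj D" and h: "h \<in> hom D Y Z" for Y Z h
    proof -
      note he = D.cmp_in_hom[OF e[OF Y] h]
      show ?thesis
        using FG[OF h Y Z] D.cmp_assoc[OF he d[OF Z] e[OF Z]] ed[OF Z] D.cmp_ident_left[OF he]
        by simp
    qed
    ultimately show ?thesis
      unfolding naturally_isomorphic_def id_func_def comp_func_def Go by (intro exI[of _ e]) simp
  qed
  ultimately show ?thesis
    unfolding is_equivalence_def using C D F by blast
qed

section \<open>Finite co-products\<close>

lemma coproduct_inclusion: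
  "is_coproduct C Xs P \<iota> \<Longrightarrow> i < length Xs \<Longrightarrow> \<iota> i \<in> hom C (Xs ! i) P"
  by (simp add: is_coproduct_def)

lemma coproduct_obj:
  "is_coproduct C Xs P \<iota> \<Longrightarrow> P \<in> obj C"
  by (simp add: is_coproduct_def)

lemma coproduct_universal:
  assumes "is_coproduct C Xs P \<iota>" "Y \<in> obj C" "\<And>i. i < length Xs \<Longrightarrow> f i \<in> hom C (Xs ! i) Y"
  shows "\<exists>!h. h \<in> hom C P Y \<and> (\<forall>i < length Xs. cmp C h (\<iota> i) = f i)"
  using assms by (simp add: is_coproduct_def)

lemma coproduct_factor:
  assumes "is_coproduct C Xs P \<iota>" "Y \<in> obj C" "\<And>i. i < length Xs \<Longrightarrow> f i \<in> hom C (Xs ! i) Y"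
  obtains h where "h \<in> hom C P Y" "\<And>i. i < length Xs \<Longrightarrow> cmp C h (\<iota> i) = f i"
proof -
  have "\<exists>!h. h \<in> hom C P Y \<and> (\<forall>i < length Xs. cmp C h (\<iota> i) = f i)"
    using assms by (rule coproduct_universal)
  then show thesis using that by blast
qed

context category
begin

lemma hom_obj:
  assumes "f \<in> hom C X Y"
  shows "X \<in> obj C" "Y \<in> obj C"
  using assms src_in_obj tgt_in_obj by (auto simp: hom_def)

text \<open>Both arrows solve the universal problem for the family of composites of \<open>k\<close>
  with the inclusions. This is the tool for all later equations between arrows out of a
  co-product.\<close>

lemma coproduct_ext:
  assumes "is_coproduct C Xs P \<iota>" "h \<in> hom C P Y" "k \<in> hom C P Y"
    and "\<And>i. i < length Xs \<Longrightarrow> cmp C h (\<iota> i) = cmp C k (\<iota> i)"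
  shows "h = k"
proof -
  have "\<exists>!h. h \<in> hom C P Y \<and> (\<forall>i < length Xs. cmp C h (\<iota> i) = cmp C k (\<iota> i))"
    by (intro coproduct_universal[OF assms(1) hom_obj(2)[OF assms(2)]]
        cmp_in_hom[OF coproduct_inclusion[OF assms(1)] assms(3)])
  then show ?thesis using assms(2-4) by blast
qed

text \<open>The arrows induced by the two families of inclusions are mutually inverse, as is seen on
  each summand. This will allow any co-product of atoms to be exchanged for the prescribed
  one.\<close>

lemma coproduct_isomorphic:
  assumes P: "is_coproduct C Xs P \<iota>" and Q: "is_coproduct C Xs Q \<kappa>"
  shows "isomorphic C P Q"
proof -
  note \<iota> = coproduct_inclusion[OF P] and \<kappa> = coproduct_inclusion[OF Q]
  obtain h where h: "h \<in> hom C P Q" "\<And>i. i < length Xs \<Longrightarrow> cmp C h (\<iota> i) = \<kappa> i"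
    using coproduct_factor[where f = \<kappa>, OF P coproduct_obj[OF Q] \<kappa>] by blast
  obtain k where k: "k \<in> hom C Q P" "\<And>i. i < length Xs \<Longrightarrow> cmp C k (\<kappa> i) = \<iota> i"
    using coproduct_factor[where f = \<iota>, OF Q coproduct_obj[OF P] \<iota>] by blast
  have "cmp C k h = ident C P"
  proof (rule coproduct_ext[OF P cmp_in_hom[OF h(1) k(1)] ident_in_hom[OF coproduct_obj[OF P]]])
    fix i assume i: "i < length Xs"
    show "cmp C (cmp C k h) (\<iota> i) = cmp C (ident C P) (\<iota> i)"
      using cmp_assoc[OF \<iota>[OF i] h(1) k(1)] h(2)[OF i] k(2)[OF i] cmp_ident_left[OF \<iota>[OF i]] by simp
  qed
  moreover have "cmp C h k = ident C Q"
  proof (rule coproduct_ext[OF Q cmp_in_hom[OF k(1) h(1)] ident_in_hom[OF coproduct_obj[OF Q]]])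
    fix i assume i: "i < length Xs"
    show "cmp C (cmp C h k) (\<kappa> i) = cmp C (ident C Q) (\<kappa> i)"
      using cmp_assoc[OF \<kappa>[OF i] k(1) h(1)] h(2)[OF i] k(2)[OF i] cmp_ident_left[OF \<kappa>[OF i]] by simp
  qed
  ultimately show ?thesis
    unfolding isomorphic_def iso_arr_def using h(1) k(1) coproduct_obj[OF P] coproduct_obj[OF Q]
    by blast
qed

text \<open>Associativity of co-products in the form needed for induction on the sequence:
  \<open>q\<close> is induced by the inclusions of the tail, and the \<open>case_nat\<close>
  expression lists the two inclusions, \<open>\<iota> 0\<close> at index 0 and \<open>q\<close> at
  index 1.\<close>

lemma coproduct_Cons:
  assumes P: "is_coproduct C (Y # Ys) P \<iota>" and Q: "is_coproduct C Ys Q \<kappa>"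
  obtains q where "q \<in> hom C Q P" "\<And>i. i < length Ys \<Longrightarrow> cmp C q (\<kappa> i) = \<iota> (Suc i)"
    and "is_coproduct C [Y, Q] P (case_nat (\<iota> 0) (\<lambda>_. q))"
proof -
  have \<iota>0: "\<iota> 0 \<in> hom C Y P"
    using coproduct_inclusion[OF P, of 0] by simp
  have \<iota>S: "\<iota> (Suc i) \<in> hom C (Ys ! i) P" if "i < length Ys" for i
    using coproduct_inclusion[OF P, of "Suc i"] that by simp
  note \<kappa> = coproduct_inclusion[OF Q]
  obtain q where q: "q \<in> hom C Q P" "\<And>i. i < length Ys \<Longrightarrow> cmp C q (\<kappa> i) = \<iota> (Suc i)"
    using coproduct_factor[where f = "\<lambda>i. \<iota> (Suc i)", OF Q coproduct_obj[OF P] \<iota>S] by blast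
  have ex: "\<exists>!h. h \<in> hom C P Z \<and> cmp C h (\<iota> 0) = f \<and> cmp C h q = k"
    if f: "f \<in> hom C Y Z" and k: "k \<in> hom C Q Z" for Z f k
  proof -
    \<comment> \<open>A cocone \<open>f\<close>, \<open>k\<close> on the pair unfolds to a cocone on
      the whole sequence by restricting \<open>k\<close> to the summands of
      \<open>Q\<close>.\<close>
    have "case_nat f (\<lambda>i. cmp C k (\<kappa> i)) i \<in> hom C ((Y # Ys) ! i) Z" if "i < length (Y # Ys)" for i
      using that f cmp_in_hom[OF \<kappa> k] by (cases i) auto
    then obtain h where h: "h \<in> hom C P Z"
      and hi: "\<And>i. i < length (Y # Ys) \<Longrightarrow> cmp C h (\<iota> i) = case_nat f (\<lambda>i. cmp C k (\<kappa> i)) i"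
      using coproduct_factor[OF P hom_obj(2)[OF f]] by blast
    have h0: "cmp C h (\<iota> 0) = f" using hi[of 0] by simp
    have hS: "cmp C h (\<iota> (Suc i)) = cmp C k (\<kappa> i)" if "i < length Ys" for i
      using hi[of "Suc i"] that by simp
    have hq: "cmp C h q = k"
    proof (rule coproduct_ext[OF Q cmp_in_hom[OF q(1) h] k])
      fix i assume i: "i < length Ys"
      show "cmp C (cmp C h q) (\<kappa> i) = cmp C k (\<kappa> i)"
        using cmp_assoc[OF \<kappa>[OF i] q(1) h] q(2)[OF i] hS[OF i] by simp
    qed
    have "h' = h" if h': "h' \<in> hom C P Z" "cmp C h' (\<iota> 0) = f" "cmp C h' q = k" for h'
    proof (rule coproduct_ext[OF P h'(1) h])
      fix i assume i: "i < length (Y # Ys)"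
      show "cmp C h' (\<iota> i) = cmp C h (\<iota> i)"
      proof (cases i)
        case 0
        then show ?thesis using h0 h'(2) by simp
      next
        case (Suc j)
        then have j: "j < length Ys" using i by simp
        show ?thesis
          using cmp_assoc[OF \<kappa>[OF j] q(1) h'(1)] q(2)[OF j] h'(3) hS[OF j] Suc by simp
      qed
    qed
    then show ?thesis using h h0 hq by blast
  qed
  have "is_coproduct C [Y, Q] P (case_nat (\<iota> 0) (\<lambda>_. q))"
    unfolding is_coproduct_def
  proof (intro conjI ballI allI impI)
    fix Z f assume "\<forall>i < length [Y, Q]. f i \<in> hom C ([Y, Q] ! i) Z"
    then have "f 0 \<in> hom C Y Z" "f 1 \<in> hom C Q Z" by fastforce+
    then show "\<exists>!h. h \<in> hom C P Z \<and>
        (\<forall>i < length [Y, Q]. cmp C h (case i of 0 \<Rightarrow> \<iota> 0 | Suc _ \<Rightarrow> q) = f i)"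
      using ex by (simp add: less_Suc_eq all_conj_distrib cong: conj_cong)
  qed (use hom_obj[OF \<iota>0] hom_obj[OF q(1)] \<iota>0 q(1) in \<open>auto simp: less_Suc_eq\<close>)
  then show thesis using that q by blast
qed

end

section \<open>Arrows between co-products of atoms\<close>

context B0_category
begin

lemma atom_obj: "is_atom B X \<Longrightarrow> X \<in> obj B"
  by (simp add: is_atom_def)

lemma no_hom_atom_initial:
  assumes X: "is_atom B X" and P: "is_coproduct B [] P \<iota>"
  shows "hom B X P = {}"
proof -
  have Po: "P \<in> obj B" using P by (rule coproduct_obj)
  have eq: "h = k" if "h \<in> hom B P Y" "k \<in> hom B P Y" for h k Y
    using coproduct_ext[OF P that] by simp
  \<comment> \<open>Parallel arrows out of \<open>P\<close> coincide by \<open>eq\<close>, so either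
    member of a cocone on the pair serves as the mediating arrow.\<close>
  have "is_coproduct B [P, P] P (\<lambda>_. ident B P)"
    unfolding is_coproduct_def
  proof (intro conjI ballI allI impI)
    fix Y f assume "\<forall>i < length [P, P]. f i \<in> hom B ([P, P] ! i) Y"
    then have f: "f 0 \<in> hom B P Y" "f 1 \<in> hom B P Y" by fastforce+
    show "\<exists>!h. h \<in> hom B P Y \<and> (\<forall>i < length [P, P]. cmp B h (ident B P) = f i)"
    proof (rule ex1I[of _ "f 0"])
      show "f 0 \<in> hom B P Y \<and> (\<forall>i < length [P, P]. cmp B (f 0) (ident B P) = f i)"
        using f eq[OF f] cmp_ident_right[OF f(1)] by (auto simp: less_Suc_eq)
    qed (use f eq in blast)
  qed (use Po ident_in_hom in \<open>auto simp: less_Suc_eq\<close>)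
  note inj = inj_onD[OF bij_betw_imp_inj_on[OF hom_atom_coproduct[OF X Po Po this]]]
  \<comment> \<open>Since both inclusions are the identity, \<open>Inl f\<close> and
    \<open>Inr f\<close> have the same image under the injective map of the binary axiom.\<close>
  have False if "f \<in> hom B X P" for f
    using inj[of "Inl f" "Inr f"] that by auto
  then show ?thesis by blast
qed

text \<open>The dependent sum over indices plays the role of the disjoint union of the hom sets, so
  a pair records the summand hit and the component. Induction on the sequence applies the binary
  axiom to the head and a co-product \<open>Q\<close> of the tail.\<close>

lemma hom_atom_finite_coproduct:
  assumes X: "is_atom B X" and P: "is_coproduct B Ys P \<iota>"
  shows "bij_betw (\<lambda>(j, g). cmp B (\<iota> j) g) (SIGMA j:{..<length Ys}. hom B X (Ys ! j)) (hom B X P)"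
  using P
proof (induction Ys arbitrary: P \<iota>)
  case Nil
  then show ?case using no_hom_atom_initial[OF X] by (simp add: bij_betw_def)
next
  case (Cons Y Ys)
  have "set (Y # Ys) \<subseteq> obj B" using Cons.prems by (simp add: is_coproduct_def)
  then have Y: "Y \<in> obj B" and Ys: "set Ys \<subseteq> obj B" by auto
  obtain Q \<kappa> where Q: "is_coproduct B Ys Q \<kappa>"
    using finite_coproducts Ys unfolding has_finite_coproducts_def by blast
  obtain q where q: "q \<in> hom B Q P" and q\<kappa>: "\<And>i. i < length Ys \<Longrightarrow> cmp B q (\<kappa> i) = \<iota> (Suc i)"
    and YQ: "is_coproduct B [Y, Q] P (case_nat (\<iota> 0) (\<lambda>_. q))"
    using coproduct_Cons[OF Cons.prems Q] by blast
  note bin = hom_atom_coproduct[OF X Y coproduct_obj[OF Q] YQ, simplified]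
  note rec = Cons.IH[OF Q]
  \<comment> \<open>Arrows into a summand of the tail reach \<open>P\<close> through
    \<open>q\<close>; this links the binary bijection with the induction hypothesis.\<close>
  have \<iota>S: "cmp B (\<iota> (Suc j)) g = cmp B q (cmp B (\<kappa> j) g)"
    if "j < length Ys" "g \<in> hom B X (Ys ! j)" for j g
    using cmp_assoc[OF that(2) coproduct_inclusion[OF Q that(1)] q] q\<kappa>[OF that(1)] by simp
  have \<kappa>g: "cmp B (\<kappa> j) g \<in> hom B X Q" if "j < length Ys" "g \<in> hom B X (Ys ! j)" for j g
    using cmp_in_hom[OF that(2) coproduct_inclusion[OF Q that(1)]] .
  \<comment> \<open>Injectivity of the binary map splits into three facts: it is injective on arrows
    to the head, injective on arrows to \<open>Q\<close>, and the two images are disjoint.\<close>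
  have inj00: "g = g'"
    if "g \<in> hom B X Y" "g' \<in> hom B X Y" "cmp B (\<iota> 0) g = cmp B (\<iota> 0) g'" for g g'
    using inj_onD[OF bij_betw_imp_inj_on[OF bin], of "Inl g" "Inl g'"] that by (simp add: InlI)
  have inj0S: "cmp B (\<iota> 0) g \<noteq> cmp B q p" if "g \<in> hom B X Y" "p \<in> hom B X Q" for g p
    using inj_onD[OF bij_betw_imp_inj_on[OF bin], of "Inl g" "Inr p"] that by auto
  have injSS: "p = p'"
    if "p \<in> hom B X Q" "p' \<in> hom B X Q" "cmp B q p = cmp B q p'" for p p'
    using inj_onD[OF bij_betw_imp_inj_on[OF bin], of "Inr p" "Inr p'"] that by (simp add: InrI)
  have "j = k \<and> g = g'"
    if "j < Suc (length Ys)" "k < Suc (length Ys)" "g \<in> hom B X ((Y # Ys) ! j)"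
      "g' \<in> hom B X ((Y # Ys) ! k)" "cmp B (\<iota> j) g = cmp B (\<iota> k) g'" for j k g g'
  proof (cases j; cases k)
    fix j' k' assume jk: "j = Suc j'" "k = Suc k'"
    then have g: "j' < length Ys" "g \<in> hom B X (Ys ! j')" "k' < length Ys" "g' \<in> hom B X (Ys ! k')"
      using that(1-4) by simp_all
    have "cmp B q (cmp B (\<kappa> j') g) = cmp B q (cmp B (\<kappa> k') g')"
      using that(5) \<iota>S[OF g(1,2)] \<iota>S[OF g(3,4)] unfolding jk by simp
    then have "cmp B (\<kappa> j') g = cmp B (\<kappa> k') g'"
      by (rule injSS[OF \<kappa>g[OF g(1,2)] \<kappa>g[OF g(3,4)]])
    then show ?thesis
      using inj_onD[OF bij_betw_imp_inj_on[OF rec], of "(j', g)" "(k', g')"] g jk by simp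
  next
    fix k' assume jk: "j = 0" "k = Suc k'"
    then have g: "g \<in> hom B X Y" "k' < length Ys" "g' \<in> hom B X (Ys ! k')"
      using that(1-4) by simp_all
    show ?thesis
      using that(5) inj0S[OF g(1) \<kappa>g[OF g(2,3)]] \<iota>S[OF g(2,3)] unfolding jk by simp
  next
    fix j' assume jk: "j = Suc j'" "k = 0"
    then have g: "g' \<in> hom B X Y" "j' < length Ys" "g \<in> hom B X (Ys ! j')"
      using that(1-4) by simp_all
    show ?thesis
      using that(5) inj0S[OF g(1) \<kappa>g[OF g(2,3)]] \<iota>S[OF g(2,3)] unfolding jk by simp
  next
    assume jk: "j = 0" "k = 0"
    then show ?thesis using inj00 that(3-5) by simp
  qed
  then have "inj_on (\<lambda>(j, g). cmp B (\<iota> j) g) (SIGMA j:{..<length (Y # Ys)}. hom B X ((Y # Ys) ! j))"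
    by (auto simp: inj_on_def)
  moreover have "(\<lambda>(j, g). cmp B (\<iota> j) g) ` (SIGMA j:{..<length (Y # Ys)}. hom B X ((Y # Ys) ! j)) =
      hom B X P" (is "?f ` ?S = _")
  proof (intro equalityI subsetI)
    fix f assume "f \<in> ?f ` ?S"
    then show "f \<in> hom B X P"
      using cmp_in_hom coproduct_inclusion[OF Cons.prems] by auto
  next
    fix f assume "f \<in> hom B X P"
    \<comment> \<open>The binary axiom makes \<open>f\<close> factor through the head, giving index
      0, or through \<open>Q\<close>; in the latter case the induction hypothesis supplies an index
      \<open>j\<close> in the tail, shifted to \<open>Suc j\<close>.\<close>
    then have "f \<in> case_sum (cmp B (\<iota> 0)) (cmp B q) ` (hom B X Y <+> hom B X Q)"
      using bij_betw_imp_surj_on[OF bin] by simp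
    then consider g where "g \<in> hom B X Y" "f = cmp B (\<iota> 0) g"
      | p where "p \<in> hom B X Q" "f = cmp B q p"
      by auto
    then show "f \<in> ?f ` ?S"
    proof cases
      case 1
      then show ?thesis by (intro image_eqI[of _ _ "(0, g)"]) auto
    next
      case 2
      then have "p \<in> (\<lambda>(j, g). cmp B (\<kappa> j) g) ` (SIGMA j:{..<length Ys}. hom B X (Ys ! j))"
        using bij_betw_imp_surj_on[OF rec] by simp
      then obtain j g where "j < length Ys" "g \<in> hom B X (Ys ! j)" "p = cmp B (\<kappa> j) g" by auto
      then show ?thesis using 2 \<iota>S by (intro image_eqI[of _ _ "(Suc j, g)"]) auto
    qed
  qed
  ultimately show ?case by (simp add: bij_betw_def)
qed

section \<open>Sequences of atoms and their arrows\<close>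

lemma obj_seq_atom_cat: "obj (seq_cat (atom_cat B)) = {Xs. \<forall>X \<in> set Xs. is_atom B X}"
  by (auto simp: seq_cat_def atom_cat_def full_subcat_def op_cat_def atom_obj)

text \<open>Two reversals cancel: \<open>atom_cat\<close> lies in the opposite of \<open>B\<close>,
  and the components of an arrow of sequences are taken in the opposite of that.\<close>

lemma hom_op_atom_cat:
  "is_atom B X \<Longrightarrow> is_atom B Y \<Longrightarrow> hom (op_cat (atom_cat B)) X Y = hom B X Y"
  by (auto simp: atom_cat_def full_subcat_def op_cat_def hom_def)

lemma category_seq_atom_cat: "category (seq_cat (atom_cat B))"
  unfolding atom_cat_def
  by (intro category_seq_cat category_full_subcat category_op_cat category_axioms)

lemma hom_seq_atom_cat:
  assumes "Xs \<in> obj (seq_cat (atom_cat B))" "Ys \<in> obj (seq_cat (atom_cat B))"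
  shows "u \<in> hom (seq_cat (atom_cat B)) Xs Ys \<longleftrightarrow>
    seq_src u = Xs \<and> seq_tgt u = Ys \<and> length (index u) = length Xs \<and> length (comps u) = length Xs \<and>
    (\<forall>i < length Xs. index u ! i < length Ys \<and> comps u ! i \<in> hom B (Xs ! i) (Ys ! (index u ! i)))"
proof -
  have "hom (op_cat (atom_cat B)) (Xs ! i) (Ys ! j) = hom B (Xs ! i) (Ys ! j)"
    if "i < length Xs" "j < length Ys" for i j
    using assms that by (intro hom_op_atom_cat) (auto simp: obj_seq_atom_cat)
  then show ?thesis
    using assms unfolding hom_def[of "seq_cat (atom_cat B)"]
    by (auto simp: seq_cat_def)
qed

end

text \<open>Co-products are determined only up to isomorphism, so the formula on objects is read for
  an arbitrary choice of co-products \<open>P\<close> with inclusions \<open>\<iota>\<close>. The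
  first conjunct guarantees that such a choice exists.\<close>

theorem proposition5p1:
  fixes B :: "('o, 'm) cat"
  assumes "B0_category B"
  shows "(\<exists>P \<iota>. \<forall>Xs \<in> obj (seq_cat (atom_cat B)). is_coproduct B Xs (P Xs) (\<iota> Xs)) \<and>
    (\<forall>P \<iota>. (\<forall>Xs \<in> obj (seq_cat (atom_cat B)). is_coproduct B Xs (P Xs) (\<iota> Xs)) \<longrightarrow>
      (\<exists>\<Phi>. is_equivalence (seq_cat (atom_cat B)) B \<Phi> \<and>
        (\<forall>Xs \<in> obj (seq_cat (atom_cat B)). fobj \<Phi> Xs = P Xs) \<and>
        (\<forall>u \<in> arr (seq_cat (atom_cat B)). \<forall>i < length (seq_src u).
           cmp B (farr \<Phi> u) (\<iota> (seq_src u) i) =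
           cmp B (\<iota> (seq_tgt u) (index u ! i)) (comps u ! i))))"
proof (intro conjI allI impI)
  interpret B0_category B by fact
  let ?S = "seq_cat (atom_cat B)"
  have "\<forall>Xs. \<exists>P \<iota>. Xs \<in> obj ?S \<longrightarrow> is_coproduct B Xs P \<iota>"
    using finite_coproducts unfolding has_finite_coproducts_def obj_seq_atom_cat
    by (metis atom_obj mem_Collect_eq subsetI)
  then show "\<exists>P \<iota>. \<forall>Xs \<in> obj ?S. is_coproduct B Xs (P Xs) (\<iota> Xs)"
    by metis
  fix P \<iota> assume "\<forall>Xs \<in> obj ?S. is_coproduct B Xs (P Xs) (\<iota> Xs)"
  then have cop: "is_coproduct B Xs (P Xs) (\<iota> Xs)" if "Xs \<in> obj ?S" for Xs
    using that by blast
  note P = coproduct_obj[OF cop] and \<iota> = coproduct_inclusion[OF cop]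
  interpret S: category ?S by (rule category_seq_atom_cat)
  have incl_comp: "cmp B (\<iota> Ys (index u ! i)) (comps u ! i) \<in> hom B (Xs ! i) (P Ys)"
    if "Xs \<in> obj ?S" "Ys \<in> obj ?S" "u \<in> hom ?S Xs Ys" "i < length Xs" for Xs Ys u i
    using that \<iota>[OF that(2)] by (auto simp: hom_seq_atom_cat intro: cmp_in_hom)
  \<comment> \<open>The arrow assigned to \<open>u\<close> is induced by the cocone whose member at
    \<open>i\<close> is the component at \<open>i\<close> followed by the inclusion of the summand
    selected by the index.\<close>
  have "\<forall>u \<in> arr ?S. \<exists>h. h \<in> hom B (P (seq_src u)) (P (seq_tgt u)) \<and> (\<forall>i < length (seq_src u).
      cmp B h (\<iota> (seq_src u) i) = cmp B (\<iota> (seq_tgt u) (index u ! i)) (comps u ! i))"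
  proof
    fix u assume "u \<in> arr ?S"
    then have u: "seq_src u \<in> obj ?S" "seq_tgt u \<in> obj ?S" "u \<in> hom ?S (seq_src u) (seq_tgt u)"
      by (auto simp: hom_def seq_cat_def)
    show "\<exists>h. h \<in> hom B (P (seq_src u)) (P (seq_tgt u)) \<and> (\<forall>i < length (seq_src u).
        cmp B h (\<iota> (seq_src u) i) = cmp B (\<iota> (seq_tgt u) (index u ! i)) (comps u ! i))"
      using coproduct_factor[where f = "\<lambda>i. cmp B (\<iota> (seq_tgt u) (index u ! i)) (comps u ! i)",
          OF cop[OF u(1)] P[OF u(2)] incl_comp[OF u]] by blast
  qed
  then obtain \<phi> where
    \<phi>: "\<And>u. u \<in> arr ?S \<Longrightarrow> \<phi> u \<in> hom B (P (seq_src u)) (P (seq_tgt u))"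
    and \<phi>\<iota>: "\<And>u i. u \<in> arr ?S \<Longrightarrow> i < length (seq_src u) \<Longrightarrow>
      cmp B (\<phi> u) (\<iota> (seq_src u) i) = cmp B (\<iota> (seq_tgt u) (index u ! i)) (comps u ! i)"
    by metis
  have homS: "u \<in> arr ?S" "seq_src u = Xs" "seq_tgt u = Ys" if "u \<in> hom ?S Xs Ys" for u Xs Ys
    using that by (auto simp: hom_def seq_cat_def)
  have \<phi>_hom: "\<phi> u \<in> hom B (P Xs) (P Ys)" if "u \<in> hom ?S Xs Ys" for u Xs Ys
    using \<phi>[OF homS(1)[OF that]] homS[OF that] by simp
  have \<phi>_incl: "cmp B (\<phi> u) (\<iota> Xs i) = cmp B (\<iota> Ys (index u ! i)) (comps u ! i)"
    if "u \<in> hom ?S Xs Ys" "i < length Xs" for u Xs Ys i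
    using \<phi>\<iota>[OF homS(1)[OF that(1)]] homS[OF that(1)] that(2) by simp
  define \<Phi> where "\<Phi> = \<lparr>fobj = P, farr = \<phi>\<rparr>"
  have "is_functor ?S B \<Phi>"
    unfolding is_functor_def
  proof (intro conjI ballI; unfold \<Phi>_def func.simps)
    fix Xs assume Xs: "Xs \<in> obj ?S"
    show "\<phi> (ident ?S Xs) = ident B (P Xs)"
    proof (rule coproduct_ext[OF cop[OF Xs] \<phi>_hom[OF S.ident_in_hom[OF Xs]] ident_in_hom[OF P[OF Xs]]])
      fix i assume i: "i < length Xs"
      show "cmp B (\<phi> (ident ?S Xs)) (\<iota> Xs i) = cmp B (ident B (P Xs)) (\<iota> Xs i)"
        using \<phi>_incl[OF S.ident_in_hom[OF Xs] i] i cmp_ident_left[OF \<iota>[OF Xs i]]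
          cmp_ident_right[OF \<iota>[OF Xs i]]
        by (simp add: seq_cat_def op_cat_def atom_cat_def full_subcat_def)
    qed
  next
    fix Xs Ys Zs u v
    assume Xs: "Xs \<in> obj ?S" and Ys: "Ys \<in> obj ?S" and Zs: "Zs \<in> obj ?S"
      and u: "u \<in> hom ?S Xs Ys" and v: "v \<in> hom ?S Ys Zs"
    note vu = S.cmp_in_hom[OF u v]
    show "\<phi> (cmp ?S v u) = cmp B (\<phi> v) (\<phi> u)"
    proof (rule coproduct_ext[OF cop[OF Xs] \<phi>_hom[OF vu] cmp_in_hom[OF \<phi>_hom[OF u] \<phi>_hom[OF v]]])
      fix i assume i: "i < length Xs"
      \<comment> \<open>Both sides are compared on one summand: \<open>u\<close> carries it to
        position \<open>j\<close> of \<open>Ys\<close>, and \<open>v\<close> carries that to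
        position \<open>k\<close> of \<open>Zs\<close>.\<close>
      define j where "j = index u ! i"
      define k where "k = index v ! j"
      have j: "j < length Ys" and ui: "comps u ! i \<in> hom B (Xs ! i) (Ys ! j)"
        using u i unfolding hom_seq_atom_cat[OF Xs Ys] j_def by auto
      have k: "k < length Zs" and vj: "comps v ! j \<in> hom B (Ys ! j) (Zs ! k)"
        using v j unfolding hom_seq_atom_cat[OF Ys Zs] k_def by auto
      have "cmp B (\<phi> (cmp ?S v u)) (\<iota> Xs i) = cmp B (\<iota> Zs k) (cmp B (comps v ! j) (comps u ! i))"
        using \<phi>_incl[OF vu i] i homS(2)[OF u]
        by (simp add: seq_cat_def op_cat_def atom_cat_def full_subcat_def j_def k_def)
      also have "\<dots> = cmp B (cmp B (\<iota> Zs k) (comps v ! j)) (comps u ! i)"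
        using cmp_assoc[OF ui vj \<iota>[OF Zs k]] .
      also have "\<dots> = cmp B (cmp B (\<phi> v) (\<iota> Ys j)) (comps u ! i)"
        using \<phi>_incl[OF v j] by (simp add: k_def)
      also have "\<dots> = cmp B (\<phi> v) (cmp B (\<iota> Ys j) (comps u ! i))"
        using cmp_assoc[OF ui \<iota>[OF Ys j] \<phi>_hom[OF v]] by simp
      also have "\<dots> = cmp B (\<phi> v) (cmp B (\<phi> u) (\<iota> Xs i))"
        using \<phi>_incl[OF u i] by (simp add: j_def)
      also have "\<dots> = cmp B (cmp B (\<phi> v) (\<phi> u)) (\<iota> Xs i)"
        using cmp_assoc[OF \<iota>[OF Xs i] \<phi>_hom[OF u] \<phi>_hom[OF v]] .
      finally show "cmp B (\<phi> (cmp ?S v u)) (\<iota> Xs i) = cmp B (cmp B (\<phi> v) (\<phi> u)) (\<iota> Xs i)" .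
    qed
  qed (use P \<phi>_hom in auto)
  moreover have "bij_betw \<phi> (hom ?S Xs Ys) (hom B (P Xs) (P Ys))"
    if Xs: "Xs \<in> obj ?S" and Ys: "Ys \<in> obj ?S" for Xs Ys
  proof -
    \<comment> \<open>Each entry of \<open>Xs\<close> is an atom, so an arrow from it to
      \<open>P Ys\<close> amounts to a position in \<open>Ys\<close> and a component. Injectivity of
      this description gives faithfulness, surjectivity gives fullness.\<close>
    have bij: "bij_betw (\<lambda>(j, g). cmp B (\<iota> Ys j) g)
        (SIGMA j:{..<length Ys}. hom B (Xs ! i) (Ys ! j)) (hom B (Xs ! i) (P Ys))"
      if "i < length Xs" for i
      using Xs that by (intro hom_atom_finite_coproduct cop Ys) (simp add: obj_seq_atom_cat)
    have "u = v" if u: "u \<in> hom ?S Xs Ys" and v: "v \<in> hom ?S Xs Ys" and eq: "\<phi> u = \<phi> v" for u v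
    proof -
      have "index u ! i = index v ! i \<and> comps u ! i = comps v ! i" if i: "i < length Xs" for i
      proof -
        have "cmp B (\<iota> Ys (index u ! i)) (comps u ! i) = cmp B (\<iota> Ys (index v ! i)) (comps v ! i)"
          using \<phi>_incl[OF u i] \<phi>_incl[OF v i] eq by simp
        then show ?thesis
          using inj_onD[OF bij_betw_imp_inj_on[OF bij[OF i]],
              of "(index u ! i, comps u ! i)" "(index v ! i, comps v ! i)"] u v i
          by (auto simp: hom_seq_atom_cat[OF Xs Ys])
      qed
      then show ?thesis
        using u v unfolding hom_seq_atom_cat[OF Xs Ys]
        by (intro seq_arr.expand) (auto intro: nth_equalityI)
    qed
    moreover have "h \<in> \<phi> ` hom ?S Xs Ys" if h: "h \<in> hom B (P Xs) (P Ys)" for h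
    proof -
      \<comment> \<open>Decomposing the restriction of \<open>h\<close> to each summand yields the
        index function \<open>a\<close> and components \<open>f\<close> of a preimage.\<close>
      have "\<exists>j g. j < length Ys \<and> g \<in> hom B (Xs ! i) (Ys ! j) \<and>
          cmp B h (\<iota> Xs i) = cmp B (\<iota> Ys j) g" if i: "i < length Xs" for i
        using bij_betw_imp_surj_on[OF bij[OF i]] cmp_in_hom[OF \<iota>[OF Xs i] h] by force
      then obtain a f where af: "\<And>i. i < length Xs \<Longrightarrow> a i < length Ys \<and>
          f i \<in> hom B (Xs ! i) (Ys ! a i) \<and> cmp B h (\<iota> Xs i) = cmp B (\<iota> Ys (a i)) (f i)"
        by metis
      define u where "u = SeqArr Xs Ys (map a [0..<length Xs]) (map f [0..<length Xs])"
      have u: "u \<in> hom ?S Xs Ys"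
        using af by (simp add: hom_seq_atom_cat[OF Xs Ys] u_def)
      have "h = \<phi> u"
        using \<phi>_incl[OF u] af
        by (intro coproduct_ext[OF cop[OF Xs] h \<phi>_hom[OF u]]) (simp add: u_def)
      then show ?thesis using u by blast
    qed
    ultimately show ?thesis
      using \<phi>_hom by (auto simp: bij_betw_def inj_on_def)
  qed
  moreover have "\<exists>Xs \<in> obj ?S. isomorphic B (P Xs) Y" if Y: "Y \<in> obj B" for Y
  proof -
    \<comment> \<open>The decomposition axiom provides some co-product \<open>Q\<close> of atoms;
      uniqueness of co-products identifies it with \<open>P Xs\<close>.\<close>
    obtain Xs Q \<kappa> where Xs: "\<forall>X \<in> set Xs. is_atom B X" and Q: "is_coproduct B Xs Q \<kappa>"
      and YQ: "isomorphic B Y Q"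
      using coproduct_of_atoms[OF Y] by blast
    have XsS: "Xs \<in> obj ?S" using Xs by (simp add: obj_seq_atom_cat)
    show ?thesis
      using isomorphic_trans[OF category_axioms coproduct_isomorphic[OF cop[OF XsS] Q]
          isomorphic_sym[OF YQ]] XsS by blast
  qed
  ultimately have "is_equivalence ?S B \<Phi>"
    using S.category_axioms category_axioms by (intro is_equivalenceI) (simp_all add: \<Phi>_def)
  moreover have "\<forall>Xs \<in> obj ?S. fobj \<Phi> Xs = P Xs"
    by (simp add: \<Phi>_def)
  moreover have "\<forall>u \<in> arr ?S. \<forall>i < length (seq_src u).
      cmp B (farr \<Phi> u) (\<iota> (seq_src u) i) = cmp B (\<iota> (seq_tgt u) (index u ! i)) (comps u ! i)"
    using \<phi>\<iota> by (simp add: \<Phi>_def)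
  ultimately show "\<exists>\<Phi>. is_equivalence ?S B \<Phi> \<and> (\<forall>Xs \<in> obj ?S. fobj \<Phi> Xs = P Xs) \<and>
      (\<forall>u \<in> arr ?S. \<forall>i < length (seq_src u).
        cmp B (farr \<Phi> u) (\<iota> (seq_src u) i) =
        cmp B (\<iota> (seq_tgt u) (index u ! i)) (comps u ! i))"
    by blast
qed

end
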